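(* Let $R$ be a commutative ring (not required to contain $1$) and let $\delta:R\to R$ be a derivation. For every integer $M\ge 0$ and all elements $f_A,f_B,f_1,\dots,f_M\in R$, $$\sum_{w\subset[1,M]}\delta^{|w^c|-1}\Big(f_A^{(1)}\prod_{i\in w^c}f_i\Big)\ \delta^{|w|}\Big(f_B\prod_{i\in w}f_i\Big)=\delta^M\Big(f_Af_B\prod_{i=1}^M f_i\Big),$$ where the sum is over all subsets $w$ of $[1,M]$, $w^c$ denotes the complement of $w$ in $[1,M]$, $f_A^{(1)}$ denotes $\delta f_A$, and in the case that $w^c$ is empty $\delta^{-1}f_A^{(1)}$ denotes $f_A$.
   Context: $[1,M]=\{i\in\mathbb{Z}:1\le i\le M\}$. A derivation is an additive map $\delta$ with $\delta(fg)=\delta(f)g+f\delta(g)$; $\delta^n$ is its $n$-fold iterate and $\delta^0$ is the identity. *)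

theory Defs
  imports Main
begin

definition derivation :: "('a::comm_ring \<Rightarrow> 'a) \<Rightarrow> bool" where
  "derivation \<delta> \<longleftrightarrow>
     (\<forall>x y. \<delta> (x + y) = \<delta> x + \<delta> y) \<and>
     (\<forall>x y. \<delta> (x * y) = \<delta> x * y + x * \<delta> y)"

(* The product of a with all f i for i in the finite set I.  A ring of class comm_ring
   need not have a unit, so the library product prod (which requires one) is not
   available; with a unit, the two agree (lemma times_prod_eq_prod). *)
definition times_prod :: "'a::comm_ring \<Rightarrow> ('i \<Rightarrow> 'a) \<Rightarrow> 'i set \<Rightarrow> 'a" where
  "times_prod a f I = Finite_Set.fold (\<lambda>i x. f i * x) a I"

lemma comp_fun_commute_times: "comp_fun_commute (\<lambda>i x. f i * (x :: 'a::comm_ring))"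
  by standard (auto simp: fun_eq_iff mult.left_commute)

lemma times_prod_empty [simp]: "times_prod a f {} = a"
  by (simp add: times_prod_def)

lemma times_prod_insert [simp]:
  assumes "finite I" "i \<notin> I"
  shows "times_prod a f (insert i I) = f i * times_prod a f I"
proof -
  interpret comp_fun_commute "\<lambda>i x. f i * x" by (rule comp_fun_commute_times)
  show ?thesis using assms by (simp add: times_prod_def)
qed

lemma times_prod_eq_prod:
  fixes a :: "'a::comm_ring_1"
  assumes "finite I"
  shows "times_prod a f I = a * (\<Prod>i\<in>I. f i)"
  using assms by (induction I) (simp_all add: mult_ac)

end

theory Submission imports Defs begin

text \<open>Write $Q_b(S) = \delta^{|S|}(b \prod_{i \in S} f_i)$ and
  $P_a(S) = \delta^{|S|-1}(\delta a \prod_{i \in S} f_i)$ with $P_a(\emptyset) = a$, and let $*$ be the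
  convolution of set functions over splittings of a set into two parts; it is commutative and
  associative. The claim is $P_a * Q_b = Q_{ab}$. One has $\delta P_a = Q_{\delta a}$,
  $Q_b(S \cup \{i\}) = \delta Q_{b f_i}(S)$ and $P_a(S \cup \{i\}) = Q_{\delta a f_i}(S)$ for
  $i \notin S$. Hence the claim for $S \cup \{i\}$ follows from the claim for $S$ together with
  $Q_{\delta a f_i} * Q_b = Q_{\delta a} * Q_{b f_i}$ on $S$. By the claim for all subsets of $S$,
  both sides of this equal $P_{f_i} * Q_{\delta a} * Q_b$.\<close>

definition subset_conv :: "('i set \<Rightarrow> 'a::comm_ring) \<Rightarrow> ('i set \<Rightarrow> 'a) \<Rightarrow> 'i set \<Rightarrow> 'a" where
  "subset_conv F G S = (\<Sum>w\<in>Pow S. F (S - w) * G w)"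

lemma subset_conv_cong:
  assumes "\<And>w. w \<subseteq> S \<Longrightarrow> F w = F' w" "\<And>w. w \<subseteq> S \<Longrightarrow> G w = G' w"
  shows "subset_conv F G S = subset_conv F' G' S"
  unfolding subset_conv_def using assms by (intro sum.cong) auto

lemma subset_conv_commute: "subset_conv F G S = subset_conv G F S"
  unfolding subset_conv_def
  by (rule sum.reindex_bij_witness[where i="\<lambda>w. S - w" and j="\<lambda>w. S - w"])
     (auto simp: double_diff mult.commute)

text \<open>Both sides sum over ordered splittings of \<open>S\<close> into three parts; finiteness
  lets the nested sums merge into one sum over pairs.\<close>

lemma subset_conv_assoc:
  assumes "finite S"
  shows "subset_conv (subset_conv F G) H S = subset_conv F (subset_conv G H) S"
proof -
  have "subset_conv (subset_conv F G) H S =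
      (\<Sum>(w, v)\<in>Sigma (Pow S) (\<lambda>w. Pow (S - w)). F (S - w - v) * G v * H w)"
    using assms by (simp add: subset_conv_def sum_distrib_right sum.Sigma)
  \<comment> \<open>The union \<open>u\<close> of \<open>w\<close> and \<open>v\<close> is the part
    shared by \<open>G\<close> and \<open>H\<close>, so \<open>v\<close> is recovered as
    \<open>u - w\<close>.\<close>
  also have "\<dots> = (\<Sum>(u, w)\<in>Sigma (Pow S) Pow. F (S - u) * (G (u - w) * H w))"
    by (rule sum.reindex_bij_witness[where i="\<lambda>(u, w). (w, u - w)" and j="\<lambda>(w, v). (w \<union> v, w)"])
       (auto simp: mult.assoc Un_Diff Diff_triv Int_commute
             intro!: arg_cong2[where f="(*)"] arg_cong[where f=F] arg_cong[where f=G])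
  also have "\<dots> = subset_conv F (subset_conv G H) S"
    using assms finite_subset by (subst sum.Sigma[symmetric])
      (auto simp: subset_conv_def sum_distrib_left)
  finally show ?thesis .
qed

text \<open>The summands come from \<open>i\<close> lying outside \<open>w\<close> and inside
  \<open>w\<close>. Adjoining \<open>i\<close> to the argument thus obeys the same product rule as
  applying a derivation.\<close>

lemma subset_conv_insert:
  assumes "finite S" "i \<notin> S"
  shows "subset_conv F G (insert i S) =
    subset_conv (\<lambda>w. F (insert i w)) G S + subset_conv F (\<lambda>w. G (insert i w)) S"
proof -
  have inj: "inj_on (insert i) (Pow S)"
    using assms(2) by (auto simp: inj_on_def)
  have "subset_conv F G (insert i S) =
      (\<Sum>w\<in>Pow S. F (insert i S - w) * G w) + (\<Sum>w\<in>insert i ` Pow S. F (insert i S - w) * G w)"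
    unfolding subset_conv_def Pow_insert using assms by (intro sum.union_disjoint) auto
  also have "(\<Sum>w\<in>Pow S. F (insert i S - w) * G w) = subset_conv (\<lambda>w. F (insert i w)) G S"
    unfolding subset_conv_def using assms(2)
    by (intro sum.cong) (auto simp: insert_Diff_if)
  also have "(\<Sum>w\<in>insert i ` Pow S. F (insert i S - w) * G w) =
      subset_conv F (\<lambda>w. G (insert i w)) S"
    unfolding subset_conv_def sum.reindex[OF inj] comp_def using assms(2)
    by (intro sum.cong refl arg_cong2[where f="(*)"] arg_cong[where f=F]) auto
  finally show ?thesis .
qed

lemma derivation_sum:
  assumes "derivation \<delta>"
  shows "\<delta> (sum g A) = (\<Sum>x\<in>A. \<delta> (g x))"
proof -
  have add: "\<delta> (x + y) = \<delta> x + \<delta> y" for x y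
    using assms by (simp add: derivation_def)
  have "\<delta> 0 = 0"
    using add[of 0 0] by simp
  then show ?thesis
    by (induction A rule: infinite_finite_induct) (simp_all add: add)
qed

lemma derivation_subset_conv:
  assumes "derivation \<delta>"
  shows "\<delta> (subset_conv F G S) =
    subset_conv (\<lambda>w. \<delta> (F w)) G S + subset_conv F (\<lambda>w. \<delta> (G w)) S"
proof -
  have "\<delta> (x * y) = \<delta> x * y + x * \<delta> y" for x y
    using assms by (simp add: derivation_def)
  then show ?thesis
    by (simp add: subset_conv_def derivation_sum[OF assms] sum.distrib)
qed

text \<open>Absorbing \<open>f i\<close> into the base trades \<open>insert i S\<close> for
  \<open>S\<close> with another base, which is why the bases must vary in the induction.\<close>

lemma times_prod_insert_base:
  assumes "finite S" "i \<notin> S"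
  shows "times_prod b f (insert i S) = times_prod (b * f i) f S"
proof -
  have "f i * times_prod b f S = times_prod (b * f i) f S"
    using assms(1) by (induction S) (simp_all add: mult.commute mult.left_commute)
  then show ?thesis
    using assms by simp
qed

definition deriv_prod :: "('a::comm_ring \<Rightarrow> 'a) \<Rightarrow> ('i \<Rightarrow> 'a) \<Rightarrow> 'a \<Rightarrow> 'i set \<Rightarrow> 'a" where
  "deriv_prod \<delta> f b S = (\<delta> ^^ card S) (times_prod b f S)"

text \<open>On finite sets this is a chosen preimage of
  \<open>deriv_prod \<delta> f (\<delta> a)\<close> under \<open>\<delta>\<close>; the value
  \<open>a\<close> makes that true at the empty set too.\<close>

definition predderiv_prod :: "('a::comm_ring \<Rightarrow> 'a) \<Rightarrow> ('i \<Rightarrow> 'a) \<Rightarrow> 'a \<Rightarrow> 'i set \<Rightarrow> 'a" where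
  "predderiv_prod \<delta> f a S =
    (if S = {} then a else (\<delta> ^^ (card S - 1)) (times_prod (\<delta> a) f S))"

lemma deriv_prod_insert:
  assumes "finite S" "i \<notin> S"
  shows "deriv_prod \<delta> f b (insert i S) = \<delta> (deriv_prod \<delta> f (b * f i) S)"
  using assms by (simp add: deriv_prod_def times_prod_insert_base del: times_prod_insert)

lemma predderiv_prod_insert:
  assumes "finite S" "i \<notin> S"
  shows "predderiv_prod \<delta> f a (insert i S) = deriv_prod \<delta> f (\<delta> a * f i) S"
  using assms
  by (simp add: predderiv_prod_def deriv_prod_def times_prod_insert_base del: times_prod_insert)

lemma deriv_predderiv_prod:
  assumes "finite S"
  shows "\<delta> (predderiv_prod \<delta> f a S) = deriv_prod \<delta> f (\<delta> a) S"
proof (cases "S = {}")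
  case False
  then obtain n where "card S = Suc n"
    using assms by (metis card_eq_0_iff not0_implies_Suc)
  then show ?thesis
    using False by (simp add: predderiv_prod_def deriv_prod_def)
qed (simp add: predderiv_prod_def deriv_prod_def)

lemma subset_conv_deriv_prod_shift:
  assumes "finite S"
    and conv: "\<And>w a b. w \<subseteq> S \<Longrightarrow>
      subset_conv (predderiv_prod \<delta> f a) (deriv_prod \<delta> f b) w = deriv_prod \<delta> f (a * b) w"
  shows "subset_conv (deriv_prod \<delta> f (u * g)) (deriv_prod \<delta> f v) S =
    subset_conv (deriv_prod \<delta> f u) (deriv_prod \<delta> f (v * g)) S"
proof -
  let ?P = "predderiv_prod \<delta> f" and ?Q = "deriv_prod \<delta> f"
  \<comment> \<open>Read backwards, \<open>conv\<close> factors \<open>?P g\<close> out of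
    \<open>?Q (x * g)\<close>; the convolution needs this on every subset of \<open>S\<close>. The
    remaining factor is symmetric in \<open>x\<close> and \<open>y\<close>.\<close>
  have split: "subset_conv (?Q (x * g)) (?Q y) S =
      subset_conv (?P g) (subset_conv (?Q x) (?Q y)) S" for x y
  proof -
    have "subset_conv (?Q (x * g)) (?Q y) S = subset_conv (subset_conv (?P g) (?Q x)) (?Q y) S"
      by (rule subset_conv_cong) (simp_all add: conv mult.commute)
    then show ?thesis
      by (simp add: subset_conv_assoc assms(1))
  qed
  have "subset_conv (?Q (u * g)) (?Q v) S = subset_conv (?Q (v * g)) (?Q u) S"
    unfolding split by (rule subset_conv_cong) (auto intro: subset_conv_commute)
  then show ?thesis
    by (simp add: subset_conv_commute)
qed

lemma subset_conv_predderiv_deriv_prod: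
  assumes \<delta>: "derivation \<delta>" and "finite S"
  shows "subset_conv (predderiv_prod \<delta> f a) (deriv_prod \<delta> f b) S = deriv_prod \<delta> f (a * b) S"
  using assms(2)
\<comment> \<open>Induction by insertion would give the claim only on the set without
  \<open>i\<close>; moving \<open>f i\<close> across needs it on all subsets of that set.\<close>
proof (induction S arbitrary: a b rule: finite_psubset_induct)
  case (psubset T)
  let ?P = "predderiv_prod \<delta> f" and ?Q = "deriv_prod \<delta> f"
  show ?case
  proof (cases "T = {}")
    case True
    then show ?thesis
      by (simp add: subset_conv_def predderiv_prod_def deriv_prod_def)
  next
    case False
    then obtain i S where T: "T = insert i S" and i: "i \<notin> S"
      by (meson Set.set_insert ex_in_conv)
    have fin: "finite S"
      using psubset.hyps T by simp
    have IH: "subset_conv (?P x) (?Q y) w = ?Q (x * y) w" if "w \<subseteq> S" for w x y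
      using psubset.IH that T i by blast
    have ins: "finite w \<and> i \<notin> w" if "w \<subseteq> S" for w
      using that fin i finite_subset by blast
    have "subset_conv (?P a) (?Q b) T =
        subset_conv (?Q (\<delta> a * f i)) (?Q b) S +
        subset_conv (?P a) (\<lambda>w. \<delta> (?Q (b * f i) w)) S"
      unfolding T subset_conv_insert[OF fin i]
      by (intro arg_cong2[where f="(+)"] subset_conv_cong)
         (simp_all add: ins predderiv_prod_insert deriv_prod_insert)
    \<comment> \<open>With \<open>f i\<close> moved across, both summands involve
      \<open>?Q (b * f i)\<close>, and together they are the product rule for a single
      convolution.\<close>
    also have "subset_conv (?Q (\<delta> a * f i)) (?Q b) S = subset_conv (?Q (\<delta> a)) (?Q (b * f i)) S"
      by (rule subset_conv_deriv_prod_shift[OF fin IH])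
    also have "\<dots> = subset_conv (\<lambda>w. \<delta> (?P a w)) (?Q (b * f i)) S"
      by (rule subset_conv_cong) (simp_all add: ins deriv_predderiv_prod)
    also have "\<dots> + subset_conv (?P a) (\<lambda>w. \<delta> (?Q (b * f i) w)) S =
        \<delta> (subset_conv (?P a) (?Q (b * f i)) S)"
      by (rule derivation_subset_conv[OF \<delta>, symmetric])
    \<comment> \<open>The claim on \<open>S\<close> with base \<open>b * f i\<close> evaluates the
      convolution; the outer \<open>\<delta>\<close> is the one that \<open>?Q\<close> gains when
      \<open>i\<close> is adjoined.\<close>
    also have "\<dots> = ?Q (a * b) T"
      by (simp add: T IH deriv_prod_insert[OF fin i] mult.assoc)
    finally show ?thesis .
  qed
qed

theorem theorem4p3:
  fixes \<delta> :: "'a::comm_ring \<Rightarrow> 'a"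
    and M :: nat
    and f\<^sub>A f\<^sub>B :: 'a
    and f :: "nat \<Rightarrow> 'a"
  assumes "derivation \<delta>"
  shows "(\<Sum>w\<in>Pow {1..M}.
            (if {1..M} - w = {} then f\<^sub>A
             else (\<delta> ^^ (card ({1..M} - w) - 1)) (times_prod (\<delta> f\<^sub>A) f ({1..M} - w)))
            * (\<delta> ^^ card w) (times_prod f\<^sub>B f w))
         = (\<delta> ^^ M) (times_prod (f\<^sub>A * f\<^sub>B) f {1..M})"
  using subset_conv_predderiv_deriv_prod[OF assms, of "{1..M}" f f\<^sub>A f\<^sub>B]
  unfolding subset_conv_def predderiv_prod_def deriv_prod_def by simp

end
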